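(* Let $k\ge 1$ be an integer. (1) If $\dfrac{a'_{2k-1}}{a'_{2k-2}}>\dfrac{\lambda_1}{-\lambda_2}\ge \dfrac{a_{2k}}{a_{2k-1}}$ (where, when $a'_{2k-2}=0$, i.e. $k=1$, this condition is understood as $\dfrac{\lambda_1}{-\lambda_2}\ge\dfrac{a_2}{a_1}$), then $H_{-2k+1}$ is the highest weight vector of $B_0(\lambda)$. (2) If $\dfrac{a_{2k}}{a_{2k-1}}>\dfrac{\lambda_1}{-\lambda_2}\ge \dfrac{a'_{2k+1}}{a'_{2k}}$, then $H_{-2k}$ is the highest weight vector of $B_0(\lambda)$.
   Context: Setting. Let $c_1,c_2$ be positive integers with $c_1c_2\ge 4$, and let $\mathfrak g$ be the rank 2 Kac–Moody algebra (of affine or hyperbolic type), $I=\{1,2\}$, with simple roots $\alpha_i$, simple coroots $h_i$ and Cartan matrix $\langle h_1,\alpha_1\rangle=\langle h_2,\alpha_2\rangle=2$, $\langle h_1,\alpha_2\rangle=-c_1$, $\langle h_2,\alpha_1\rangle=-c_2$. Let $\lambda=\lambda_1\Lambda_1+\lambda_2\Lambda_2$ with $\Lambda_i$ the fundamental weights (so $\langle h_i,\lambda\rangle=\lambda_i$), $\lambda_1\in\mathbb Z_{>0}$, $\lambda_2\in\mathbb Z_{<0}$. The crystal $\mathbb Z^\infty_\iota[\lambda]$. Fix $\iota=(\dots,i_2,i_1,t_\lambda,i_{-1},i_{-2},\dots)=(\dots,1,2,1,t_\lambda,2,1,2,\dots)$, i.e. $i_k=1$ for $k>0$ odd, $i_k=2$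 for $k>0$ even, $i_{-k}=2$ for $k>0$ odd, $i_{-k}=1$ for $k>0$ even. As a set, $\mathbb Z^\infty_\iota[\lambda]$ consists of the sequences $\vec x=(\dots,x_2,x_1,t_\lambda,x_{-1},x_{-2},\dots)$ with $x_k\in\mathbb Z$ ($k\in\mathbb Z\setminus\{0\}$), all but finitely many zero ($t_\lambda$ is a formal symbol). There is no coordinate $x_0$; sums run over nonzero indices. Put $\sigma_k(\vec x)=x_k+\sum_{j>k}\langle h_{i_k},\alpha_{i_j}\rangle x_j$ for $k\ge1$ and $\sigma_k(\vec x)=-\langle h_{i_k},\lambda\rangle+x_k+\sum_{j>k}\langle h_{i_k},\alpha_{i_j}\rangle x_j$ for $k\le -1$. Let $\sigma^{(i)}(\vec x)=\max_{k:\,i_k=i}\sigma_k(\vec x)$ and $M^{(i)}=\{k: i_k=i,\ \sigma_k(\vec x)=\sigma^{(i)}(\vec x)\}$. The crystal operators are: $\tilde e_i\vec x$ is obtained from $\vec x$ by decreasing $x_{\max M^{(i)}}$ by 1 if $\max M^{(i)}$ exists, and $\tilde e_i\vec x=0$ otherwise; $\tilde f_i\vec x$ is obtained from $\vec x$ by increasing $x_{\min M^{(i)}}$ by 1 if $\min M^{(i)}$ exists, and $\tilde f_i\vec x=0$ otherwise. Also $wt(\vec x)=\lambda-\sum_j x_j\alpha_{i_j}$, $\varepsilon_i(\vec x)=\sigma^{(i)}(\vec x)$, $\varphi_i(\vec x)=\langle h_i,wt(\vec x)\rangle+\varepsilon_i(\vec x)$. $B_0(\lambda)$. The crystal $B(U_q(\mathfrak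 g)a_\lambda)\cong B(\infty)\otimes T_\lambda\otimes B(-\infty)$ of the modified quantum algebra is identified with its image under the unique strict embedding into $\mathbb Z^\infty_\iota[\lambda]$ sending $u_\infty\otimes t_\lambda\otimes u_{-\infty}$ to $(\dots,0,0,t_\lambda,0,0,\dots)$. $B_0(\lambda)$ is its connected component containing $u_\infty\otimes t_\lambda\otimes u_{-\infty}$; equivalently, the connected component of $(\dots,0,0,t_\lambda,0,0,\dots)$ in $\mathbb Z^\infty_\iota[\lambda]$. A highest weight vector of a crystal is an element $b$ with $\tilde e_ib=0$ for all $i\in I$. The integers $a_l,a'_l$. The Chebyshev polynomials $P_k(X)$ ($k\ge0$) are defined by $P_k(\alpha+\alpha^{-1})=\dfrac{\alpha^{k+1}-\alpha^{-k-1}}{\alpha-\alpha^{-1}}$. With $X=c_1c_2-2$: $a_0=a'_0=0$, $a_1=a'_1=1$, and for $k\ge1$: $a_{2k}=c_1P_{k-1}(X)$, $a'_{2k}=c_2P_{k-1}(X)$, $a_{2k+1}=a'_{2k+1}=P_k(X)+P_{k-1}(X)$. The vectors $H_{-j}$. For $k,j\ge1$: $h_{-2k+1}=a'_{2k-2}\lambda_1+a'_{2k-1}\lambda_2$, $h_{-2k}=a_{2k-1}\lambda_1+a_{2k}\lambda_2$ (integers, not to be confused with the coroots $h_1,h_2$), and $H_{-j}=(\dots,0,0,t_\lambda,h_{-1},h_{-2},\dots,h_{-j},0,0,\dots)$. *)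

theory Defs
  imports Complex_Main "HOL-Computational_Algebra.Polynomial"
begin

text \<open>
  Throughout, \<open>c1 c2\<close> are the off-diagonal entries of the Cartan matrix (up to sign) and
  \<open>l1 l2\<close> are the coefficients of \<open>\<lambda> = l1 \<Lambda>\<^sub>1 + l2 \<Lambda>\<^sub>2\<close>.  The index set \<open>I\<close> is
  \<open>{1, 2} :: nat set\<close>.
\<close>

definition cartan :: "int \<Rightarrow> int \<Rightarrow> nat \<Rightarrow> nat \<Rightarrow> int" where
  "cartan c1 c2 i j = (if i = j then 2 else if i = 1 then - c1 else - c2)"

definition pairing_wt :: "int \<Rightarrow> int \<Rightarrow> nat \<Rightarrow> int" where
  "pairing_wt l1 l2 i = (if i = 1 then l1 else l2)"

definition iota :: "int \<Rightarrow> nat" where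
  "iota k = (if k > 0 then (if odd k then 1 else 2) else (if odd k then 2 else 1))"

text \<open>
  A sequence is a function on all integers; position \<open>0\<close> stands for the formal symbol
  \<open>t\<^sub>\<lambda>\<close> and carries no coordinate: it is pinned to \<open>0\<close> and is never an admissible index below.
\<close>

definition Zinf :: "(int \<Rightarrow> int) set" where
  "Zinf = {x. x 0 = 0 \<and> finite {k. x k \<noteq> 0}}"

definition sigma :: "int \<Rightarrow> int \<Rightarrow> int \<Rightarrow> int \<Rightarrow> (int \<Rightarrow> int) \<Rightarrow> int \<Rightarrow> int" where
  "sigma c1 c2 l1 l2 x k =
     (if k \<ge> 1 then 0 else - pairing_wt l1 l2 (iota k))
     + x k + (\<Sum>j \<in> {j. j > k \<and> j \<noteq> 0 \<and> x j \<noteq> 0}. cartan c1 c2 (iota k) (iota j) * x j)"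

text \<open>
  For \<open>x \<in> Zinf\<close> the set of values below is finite, since \<open>sigma\<close> is eventually constant
  in both directions along the indices of each colour (lemma \<open>finite_sigma_values\<close>).
\<close>

definition sigma_max :: "int \<Rightarrow> int \<Rightarrow> int \<Rightarrow> int \<Rightarrow> nat \<Rightarrow> (int \<Rightarrow> int) \<Rightarrow> int" where
  "sigma_max c1 c2 l1 l2 i x = Max {sigma c1 c2 l1 l2 x k |k. k \<noteq> 0 \<and> iota k = i}"

definition M_set :: "int \<Rightarrow> int \<Rightarrow> int \<Rightarrow> int \<Rightarrow> nat \<Rightarrow> (int \<Rightarrow> int) \<Rightarrow> int set" where
  "M_set c1 c2 l1 l2 i x =
     {k. k \<noteq> 0 \<and> iota k = i \<and> sigma c1 c2 l1 l2 x k = sigma_max c1 c2 l1 l2 i x}"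

text \<open>
  The Kashiwara operators; \<open>None\<close> is the extra element \<open>0\<close> of the crystal.  \<open>M_set\<close> may be
  unbounded above (resp. below), and then its maximum (resp. minimum) does not exist.
\<close>

definition e_op :: "int \<Rightarrow> int \<Rightarrow> int \<Rightarrow> int \<Rightarrow> nat \<Rightarrow> (int \<Rightarrow> int) \<Rightarrow> (int \<Rightarrow> int) option" where
  "e_op c1 c2 l1 l2 i x =
     (let M = M_set c1 c2 l1 l2 i x in
      if \<exists>m\<in>M. \<forall>k\<in>M. k \<le> m
      then (let m = (GREATEST k. k \<in> M) in Some (x(m := x m - 1)))
      else None)"

definition f_op :: "int \<Rightarrow> int \<Rightarrow> int \<Rightarrow> int \<Rightarrow> nat \<Rightarrow> (int \<Rightarrow> int) \<Rightarrow> (int \<Rightarrow> int) option" where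
  "f_op c1 c2 l1 l2 i x =
     (let M = M_set c1 c2 l1 l2 i x in
      if \<exists>m\<in>M. \<forall>k\<in>M. m \<le> k
      then (let m = (LEAST k. k \<in> M) in Some (x(m := x m + 1)))
      else None)"

definition crystal_edges :: "int \<Rightarrow> int \<Rightarrow> int \<Rightarrow> int \<Rightarrow> ((int \<Rightarrow> int) \<times> (int \<Rightarrow> int)) set" where
  "crystal_edges c1 c2 l1 l2 =
     {(x, y). x \<in> Zinf \<and> y \<in> Zinf \<and>
        (\<exists>i\<in>{1, 2}. e_op c1 c2 l1 l2 i x = Some y \<or> f_op c1 c2 l1 l2 i x = Some y)}"

text \<open>
  The crystal \<open>B(U\<^sub>q(g)a\<^sub>\<lambda>)\<close> is identified with its image under the strict embedding into
  \<open>Zinf\<close> that sends \<open>u\<^sub>\<infinity> \<otimes> t\<^sub>\<lambda> \<otimes> u\<^bsub>-\<infinity>\<^esub>\<close> to the zero sequence.  Strict embeddings commute with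
  the Kashiwara operators, so the component of that element is the component of the zero
  sequence in \<open>Zinf\<close>.
\<close>

definition B0 :: "int \<Rightarrow> int \<Rightarrow> int \<Rightarrow> int \<Rightarrow> (int \<Rightarrow> int) set" where
  "B0 c1 c2 l1 l2 =
     {x. (\<lambda>_. 0, x) \<in> (crystal_edges c1 c2 l1 l2 \<union> (crystal_edges c1 c2 l1 l2)\<inverse>)\<^sup>*}"

definition highest_weight_vectors ::
    "int \<Rightarrow> int \<Rightarrow> int \<Rightarrow> int \<Rightarrow> (int \<Rightarrow> int) set \<Rightarrow> (int \<Rightarrow> int) set" where
  "highest_weight_vectors c1 c2 l1 l2 B = {b \<in> B. \<forall>i\<in>{1, 2}. e_op c1 c2 l1 l2 i b = None}"

definition is_chebyshev :: "nat \<Rightarrow> int poly \<Rightarrow> bool" where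
  "is_chebyshev k p \<longleftrightarrow>
     (\<forall>\<alpha>::complex. \<alpha> \<noteq> 0 \<and> \<alpha> \<noteq> inverse \<alpha> \<longrightarrow>
        poly (map_poly of_int p) (\<alpha> + inverse \<alpha>)
          = (\<alpha> ^ (k + 1) - inverse \<alpha> ^ (k + 1)) / (\<alpha> - inverse \<alpha>))"

text \<open>Existence and uniqueness are shown in \<open>ex1_chebyshev\<close>.\<close>

definition chebyshev :: "nat \<Rightarrow> int poly" where
  "chebyshev k = (THE p. is_chebyshev k p)"

definition cheb_val :: "int \<Rightarrow> int \<Rightarrow> nat \<Rightarrow> int" where
  "cheb_val c1 c2 k = poly (chebyshev k) (c1 * c2 - 2)"

definition a_seq :: "int \<Rightarrow> int \<Rightarrow> nat \<Rightarrow> int" where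
  "a_seq c1 c2 l =
     (if l = 0 then 0 else if l = 1 then 1
      else if even l then c1 * cheb_val c1 c2 (l div 2 - 1)
      else cheb_val c1 c2 (l div 2) + cheb_val c1 c2 (l div 2 - 1))"

definition a'_seq :: "int \<Rightarrow> int \<Rightarrow> nat \<Rightarrow> int" where
  "a'_seq c1 c2 l =
     (if l = 0 then 0 else if l = 1 then 1
      else if even l then c2 * cheb_val c1 c2 (l div 2 - 1)
      else cheb_val c1 c2 (l div 2) + cheb_val c1 c2 (l div 2 - 1))"

text \<open>\<open>h_coord c1 c2 l1 l2 j\<close> is \<open>h\<^bsub>-j\<^esub>\<close> and \<open>H_vec c1 c2 l1 l2 j\<close> is \<open>H\<^bsub>-j\<^esub>\<close>, for \<open>j \<ge> 1\<close>.\<close>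

definition h_coord :: "int \<Rightarrow> int \<Rightarrow> int \<Rightarrow> int \<Rightarrow> nat \<Rightarrow> int" where
  "h_coord c1 c2 l1 l2 j =
     (if odd j then a'_seq c1 c2 (j - 1) * l1 + a'_seq c1 c2 j * l2
      else a_seq c1 c2 (j - 1) * l1 + a_seq c1 c2 j * l2)"

definition H_vec :: "int \<Rightarrow> int \<Rightarrow> int \<Rightarrow> int \<Rightarrow> nat \<Rightarrow> int \<Rightarrow> int" where
  "H_vec c1 c2 l1 l2 j = (\<lambda>m. if - int j \<le> m \<and> m \<le> -1 then h_coord c1 c2 l1 l2 (nat (- m)) else 0)"


lemma finite_sigma_values:
  assumes "x \<in> Zinf"
  shows "finite {sigma c1 c2 l1 l2 x k |k. k \<noteq> 0 \<and> iota k = i}"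
proof -
  let ?S = "{k. x k \<noteq> 0}"
  have fin: "finite ?S" using assms by (simp add: Zinf_def)
  let ?g = "\<lambda>(b, v, T). (if b then 0 else - pairing_wt l1 l2 i) + v
              + (\<Sum>j\<in>T. cartan c1 c2 i (iota j) * x j)"
  have "{sigma c1 c2 l1 l2 x k |k. k \<noteq> 0 \<and> iota k = i}
          \<subseteq> ?g ` (UNIV \<times> insert 0 (x ` ?S) \<times> Pow ?S)"
  proof
    fix s assume "s \<in> {sigma c1 c2 l1 l2 x k |k. k \<noteq> 0 \<and> iota k = i}"
    then obtain k where k: "s = sigma c1 c2 l1 l2 x k" "iota k = i" by blast
    have "s = ?g (k \<ge> 1, x k, {j. j > k \<and> j \<noteq> 0 \<and> x j \<noteq> 0})"
      using k by (simp add: sigma_def)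
    moreover have "(k \<ge> 1, x k, {j. j > k \<and> j \<noteq> 0 \<and> x j \<noteq> 0})
        \<in> UNIV \<times> insert 0 (x ` ?S) \<times> Pow ?S" by auto
    ultimately show "s \<in> ?g ` (UNIV \<times> insert 0 (x ` ?S) \<times> Pow ?S)" by blast
  qed
  moreover have "finite (?g ` (UNIV \<times> insert 0 (x ` ?S) \<times> Pow ?S))"
    using fin by simp
  ultimately show ?thesis by (rule finite_subset)
qed

lemma is_chebyshev_unique:
  assumes "is_chebyshev k p" "is_chebyshev k q"
  shows "p = q"
proof -
  let ?c = "map_poly (of_int :: int \<Rightarrow> complex)"
  have eq: "poly (?c p) z = poly (?c q) z" if z: "z \<notin> {2, -2}" for z
  proof -
    define s where "s = csqrt (z^2 - 4)"
    define \<alpha> where "\<alpha> = (z + s) / 2"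
    have s2: "s^2 = z^2 - 4" by (simp add: s_def)
    have s0: "s \<noteq> 0"
    proof
      assume "s = 0"
      hence "(z - 2) * (z + 2) = 0" using s2 by (simp add: algebra_simps power2_eq_square)
      thus False using z by (auto simp: eq_neg_iff_add_eq_0)
    qed
    have one: "\<alpha> * ((z - s) / 2) = 1"
      using s2 by (simp add: \<alpha>_def field_simps power2_eq_square)
    hence inv: "inverse \<alpha> = (z - s) / 2" by (rule inverse_unique)
    have \<alpha>0: "\<alpha> \<noteq> 0" using one by auto
    have sum: "\<alpha> + inverse \<alpha> = z" unfolding inv by (simp add: \<alpha>_def field_simps)
    have "\<alpha> - inverse \<alpha> = s" unfolding inv by (simp add: \<alpha>_def field_simps)
    hence "\<alpha> \<noteq> inverse \<alpha>" using s0 by auto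
    thus ?thesis using assms \<alpha>0 sum unfolding is_chebyshev_def by metis
  qed
  have "?c p = ?c q"
  proof (rule ccontr)
    assume "?c p \<noteq> ?c q"
    hence "finite {z. poly (?c p - ?c q) z = 0}" by (intro poly_roots_finite) simp
    moreover have "- {2, -2} \<subseteq> {z. poly (?c p - ?c q) z = 0}" using eq by auto
    ultimately have "finite (- {2, -2 :: complex})" by (rule finite_subset[rotated])
    hence "finite (UNIV :: complex set)" by (simp add: Compl_eq_Diff_UNIV)
    thus False using infinite_UNIV_char_0 by blast
  qed
  hence "coeff (?c p) n = coeff (?c q) n" for n by simp
  hence "coeff p n = coeff q n" for n by (simp add: coeff_map_poly)
  thus ?thesis by (simp add: poly_eq_iff)
qed

lemma is_chebyshev_0: "is_chebyshev 0 1"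
  by (simp add: is_chebyshev_def)

lemma is_chebyshev_1: "is_chebyshev (Suc 0) [:0, 1:]"
  by (auto simp: is_chebyshev_def map_poly_pCons field_simps power2_eq_square)

lemma is_chebyshev_step:
  assumes p: "is_chebyshev k p" and q: "is_chebyshev (Suc k) q"
  shows "is_chebyshev (Suc (Suc k)) ([:0, 1:] * q - p)"
  unfolding is_chebyshev_def
proof (intro allI impI)
  fix \<alpha> :: complex assume a: "\<alpha> \<noteq> 0 \<and> \<alpha> \<noteq> inverse \<alpha>"
  let ?b = "inverse \<alpha>" let ?d = "\<alpha> - ?b"
  have ab: "\<alpha> * ?b = 1" and d: "?d \<noteq> 0" using a by auto
  have map: "map_poly of_int ([:0, 1:] * q - p)
      = [:0, 1:] * map_poly of_int q - (map_poly of_int p :: complex poly)"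
    by (rule poly_eqI) (simp add: coeff_map_poly coeff_pCons split: nat.split)
  have "(\<alpha> + ?b) * (\<alpha> ^ (k + 2) - ?b ^ (k + 2)) - (\<alpha> ^ (k + 1) - ?b ^ (k + 1))
      = (\<alpha> ^ (k + 3) - ?b ^ (k + 3)) + (\<alpha> * ?b - 1) * (\<alpha> ^ (k + 1) - ?b ^ (k + 1))"
    by (simp add: algebra_simps power_add power2_eq_square power3_eq_cube)
  hence e: "(\<alpha> + ?b) * (\<alpha> ^ (k + 2) - ?b ^ (k + 2)) - (\<alpha> ^ (k + 1) - ?b ^ (k + 1))
      = \<alpha> ^ (k + 3) - ?b ^ (k + 3)"
    unfolding ab by simp
  have gen: "u * (A / d) - B / d = (u * A - B) / d" for u A B d :: complex
    by (simp add: diff_divide_distrib)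
  have "poly (map_poly of_int ([:0, 1:] * q - p)) (\<alpha> + ?b)
      = (\<alpha> + ?b) * ((\<alpha> ^ (k + 2) - ?b ^ (k + 2)) / ?d) - (\<alpha> ^ (k + 1) - ?b ^ (k + 1)) / ?d"
    using p q a unfolding is_chebyshev_def map by simp
  also have "\<dots> = ((\<alpha> + ?b) * (\<alpha> ^ (k + 2) - ?b ^ (k + 2)) - (\<alpha> ^ (k + 1) - ?b ^ (k + 1))) / ?d"
    by (rule gen)
  finally show "poly (map_poly of_int ([:0, 1:] * q - p)) (\<alpha> + ?b)
      = (\<alpha> ^ (Suc (Suc k) + 1) - ?b ^ (Suc (Suc k) + 1)) / ?d"
    unfolding e by (simp only: numeral_3_eq_3 add_Suc_right add_Suc One_nat_def add_0_right)
qed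

lemma ex_chebyshev: "\<exists>p. is_chebyshev k p"
proof (induction k rule: less_induct)
  case (less k)
  consider "k = 0" | "k = Suc 0" | m where "k = Suc (Suc m)"
    by (metis not0_implies_Suc)
  thus ?case
  proof cases
    case 3
    then obtain p q where "is_chebyshev m p" "is_chebyshev (Suc m) q"
      using less.IH[of m] less.IH[of "Suc m"] by auto
    thus ?thesis using is_chebyshev_step 3 by blast
  qed (use is_chebyshev_0 is_chebyshev_1 in blast)+
qed

lemma ex1_chebyshev: "\<exists>!p. is_chebyshev k p"
  using ex_chebyshev is_chebyshev_unique by blast

lemma is_chebyshev_chebyshev: "is_chebyshev k (chebyshev k)"
  unfolding chebyshev_def by (rule theI') (rule ex1_chebyshev)

lemma chebyshev_0: "chebyshev 0 = 1"
  using is_chebyshev_unique is_chebyshev_chebyshev is_chebyshev_0 by blast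

lemma chebyshev_1: "chebyshev (Suc 0) = [:0, 1:]"
  using is_chebyshev_unique is_chebyshev_chebyshev is_chebyshev_1 by blast

lemma chebyshev_Suc_Suc:
  "chebyshev (Suc (Suc k)) = [:0, 1:] * chebyshev (Suc k) - chebyshev k"
  using is_chebyshev_unique is_chebyshev_chebyshev is_chebyshev_step by blast

end

theory Submission
  imports Defs
begin

text \<open>
  The pairs \<open>T\<^sub>\<lambda> \<otimes> B\<^sub>i\<close> and \<open>B\<^sub>i \<otimes> T\<^bsub>s\<^sub>i\<lambda>\<^esub>\<close> are isomorphic crystals, so the symbol \<open>t\<^sub>\<lambda>\<close> can be moved
  to the right past the first \<open>j\<close> negative positions; \<open>\<lambda>\<close> then becomes its image \<open>\<lambda>'\<close> under \<open>j\<close>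
  simple reflections, and the coordinates that are passed are shifted by the numbers \<open>h\<^bsub>-1\<^esub>, \<dots>, h\<^bsub>-j\<^esub>\<close>.
  In other words \<open>H\<^bsub>-j\<^esub>\<close> becomes the zero sequence of a crystal of the same shape.  The ratio
  conditions ensure that \<open>\<lambda>'\<close>, whose coordinates are \<open>-h\<^bsub>-j\<^esub>\<close> and \<open>h\<^bsub>-j-1\<^esub>\<close>, is dominant.
  For a dominant weight the component of the zero sequence is the crystal of an integrable highest
  weight module, and it is contained in an explicit set of lattice points: all coordinates at negative
  positions vanish, the positive part satisfies the inequalities of the polyhedral realization of
  \<open>B(\<infinity>)\<close>, and one further bound for each simple root encodes \<open>\<epsilon>\<^sub>i\<^sup>* \<le> \<langle>h\<^sub>i, \<lambda>'\<rangle>\<close>.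

  Concretely, numbering the nonzero positions consecutively (\<open>pos\<close>), the differences \<open>gap\<close> of
  consecutive values \<open>\<sigma>\<^sub>k\<close> of one colour are three-term expressions in the coordinates, with the
  weight entering only as two constants next to the seam.  The isomorphism above is the
  statement \<open>gap_rel_coord\<close>: passing to coordinates relative to \<open>H\<^bsub>-j\<^esub>\<close> turns the gaps for \<open>\<lambda>\<close>
  into the gaps for \<open>\<lambda>'\<close>.  The operators only matter through the gaps at the
  position where they act and at the preceding one of the same colour (\<open>crystal_edges_raises\<close>), and
  subtracting a multiple of a gap turns each inequality of \<open>polyhedron\<close> into the next one of its
  family, whence the polyhedron is stable under the operators (\<open>polyhedron_raise\<close>,
  \<open>polyhedron_lower\<close>).

  The zero sequence of the original crystal lies in the polyhedron of \<open>\<lambda>'\<close>, so \<open>B\<^sub>0(\<lambda>)\<close> does too.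
  A point of the polyhedron other than its apex \<open>H\<^bsub>-j\<^esub>\<close> has a last nonzero relative coordinate; it
  is positive and makes some \<open>\<sigma>\<^sub>k\<close> positive, so the point is not a highest weight vector.  Finally
  the operators \<open>e\<^sub>i\<close> lower the sum of all coordinates, which is bounded below on the polyhedron, so
  applying them to the zero sequence must end, and it can only end at \<open>H\<^bsub>-j\<^esub>\<close>.
\<close>

section \<open>The coefficient sequences\<close>

text \<open>
  Both \<open>a\<^sub>l\<close> and \<open>a'\<^sub>l\<close> satisfy one linear recurrence with alternating coefficients; only the order
  of the two coefficients differs.  This form, and not the Chebyshev formula, is what the inequalities
  below consume.
\<close>

fun alt_rec :: "int \<Rightarrow> int \<Rightarrow> nat \<Rightarrow> int" where
  "alt_rec a b 0 = 0"
| "alt_rec a b (Suc 0) = 1"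
| "alt_rec a b (Suc (Suc n)) = (if even n then a else b) * alt_rec a b (Suc n) - alt_rec a b n"

text \<open>
  Positivity alone does not pass through the recurrence.  The inequality
  \<open>2 r\<^bsub>n+1\<^esub> > d r\<^sub>n\<close> does, where \<open>d\<close> is the coefficient used one step earlier: doubling
  \<open>2 r\<^bsub>n+2\<^esub> - c r\<^bsub>n+1\<^esub> = c r\<^bsub>n+1\<^esub> - 2 r\<^sub>n\<close> leaves a number above \<open>(c d - 4) r\<^sub>n\<close>, which is where
  \<open>a b \<ge> 4\<close> enters.
\<close>

lemma alt_rec_pos_aux:
  assumes "a > 0" "b > 0" "a * b \<ge> 4"
  shows "alt_rec a b n \<ge> 0 \<and> 2 * alt_rec a b (Suc n) > (if even n then b else a) * alt_rec a b n"
proof (induction n)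
  case 0
  show ?case by simp
next
  case (Suc n)
  define c where "c = (if even n then a else b)"
  define d where "d = (if even n then b else a)"
  define r where "r = alt_rec a b n"
  define s where "s = alt_rec a b (Suc n)"
  have cd: "c > 0" "d > 0" "c * d \<ge> 4"
    using assms by (auto simp: c_def d_def mult.commute)
  have IH: "r \<ge> 0" "2 * s > d * r"
    using Suc by (auto simp: r_def s_def d_def)
  have s: "s \<ge> 0"
    using IH cd by (smt (verit) mult_nonneg_nonneg)
  have "c * (2 * s) > c * (d * r)"
    using IH cd by (intro mult_strict_left_mono)
  moreover have "(c * d) * r \<ge> 4 * r"
    using IH cd by (intro mult_right_mono)
  ultimately have "2 * (c * s - r) > c * s"
    by (simp add: algebra_simps)
  with s show ?case
    by (auto simp: c_def r_def s_def mult.commute)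
qed

lemma alt_rec_pos:
  assumes "a > 0" "b > 0" "a * b \<ge> 4"
  shows "alt_rec a b n \<ge> 0" and "alt_rec a b (Suc n) > 0"
proof -
  show "alt_rec a b n \<ge> 0"
    using alt_rec_pos_aux[OF assms] by blast
  have "(if even n then b else a) * alt_rec a b n \<ge> 0"
    using alt_rec_pos_aux[OF assms, of n] assms by auto
  with alt_rec_pos_aux[OF assms, of n] show "alt_rec a b (Suc n) > 0"
    by linarith
qed

lemma cheb_val_rec:
  "cheb_val c1 c2 0 = 1"
  "cheb_val c1 c2 (Suc 0) = c1 * c2 - 2"
  "cheb_val c1 c2 (Suc (Suc n)) = (c1 * c2 - 2) * cheb_val c1 c2 (Suc n) - cheb_val c1 c2 n"
  by (simp_all add: cheb_val_def chebyshev_0 chebyshev_1 chebyshev_Suc_Suc)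

lemma alt_rec_cheb_val:
  "alt_rec a b (2 * n + 2) = a * cheb_val a b n \<and>
   alt_rec a b (2 * n + 3) = cheb_val a b (Suc n) + cheb_val a b n"
proof (induction n)
  case 0
  show ?case by (simp add: cheb_val_rec numeral_2_eq_2 numeral_3_eq_3 algebra_simps)
next
  case (Suc n)
  have e: "alt_rec a b (2 * Suc n + 2) = a * alt_rec a b (2 * n + 3) - alt_rec a b (2 * n + 2)"
  proof -
    have "2 * Suc n + 2 = Suc (Suc (2 * n + 2))" "2 * n + 3 = Suc (2 * n + 2)" by simp_all
    then show ?thesis by (simp only: alt_rec.simps) simp
  qed
  have o: "alt_rec a b (2 * Suc n + 3) = b * alt_rec a b (2 * Suc n + 2) - alt_rec a b (2 * n + 3)"
  proof -
    have "2 * Suc n + 3 = Suc (Suc (2 * n + 3))" "2 * Suc n + 2 = Suc (2 * n + 3)" by simp_all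
    then show ?thesis by (simp only: alt_rec.simps) simp
  qed
  have e': "alt_rec a b (2 * Suc n + 2) = a * cheb_val a b (Suc n)"
    unfolding e using Suc by (simp add: algebra_simps)
  show ?case
    unfolding o unfolding e' using Suc by (simp add: cheb_val_rec algebra_simps)
qed

lemma a_seq_eq_alt_rec: "a_seq c1 c2 l = alt_rec c1 c2 l"
proof -
  consider "l = 0" | "l = 1" | n where "l = 2 * n + 2" | n where "l = 2 * n + 3"
  proof (cases "l \<le> 1")
    case True
    then show ?thesis using that by linarith
  next
    case False
    then have "l = 2 * ((l - 2) div 2) + 2 \<or> l = 2 * ((l - 3) div 2) + 3" by presburger
    then show ?thesis using that(3,4) by blast
  qed
  then show ?thesis
    by cases (use alt_rec_cheb_val[of c1 c2] in \<open>auto simp: a_seq_def\<close>)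
qed

lemma cheb_val_commute: "cheb_val c1 c2 n = cheb_val c2 c1 n"
  by (simp add: cheb_val_def mult.commute)

lemma a'_seq_eq_alt_rec: "a'_seq c1 c2 l = alt_rec c2 c1 l"
  unfolding a_seq_eq_alt_rec[symmetric] a_seq_def a'_seq_def
  by (simp add: cheb_val_commute[of c1])

section \<open>The polyhedron of a dominant weight\<close>

text \<open>
  \<open>gap a b mu nu w q\<close> is \<open>\<sigma>\<^sub>q - \<sigma>\<^bsub>q+2\<^esub>\<close> for a sequence \<open>w\<close> indexed by all integers, without a hole at the
  formal symbol.  The symbol sits between the positions \<open>0\<close> and \<open>1\<close>, which is why the pairings of the
  weight with the two coroots appear only at \<open>q = 0\<close> (as \<open>mu\<close>) and \<open>q = -1\<close> (as \<open>nu\<close>).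
\<close>

definition gap :: "int \<Rightarrow> int \<Rightarrow> int \<Rightarrow> int \<Rightarrow> (int \<Rightarrow> int) \<Rightarrow> int \<Rightarrow> int" where
  "gap a b mu nu w q =
     w q + w (q + 2) - (if odd q then a else b) * w (q + 1)
       - (if q = 0 then mu else if q = - 1 then nu else 0)"

text \<open>
  The first family of inequalities cuts out \<open>B(\<infinity>)\<close>.  The bound \<open>w 1 \<le> nu\<close> and the last
  family express \<open>\<epsilon>\<^sub>i\<^sup>* \<le> \<langle>h\<^sub>i, \<lambda>'\<rangle>\<close> for the colour of position \<open>1\<close> and for the other colour.  In each
  family, a form becomes the next one after subtraction of a multiple of a gap; the first form of the
  last family arises from \<open>mu\<close> in the same way, using the gap at \<open>0\<close>.
\<close>

definition polyhedron :: "int \<Rightarrow> int \<Rightarrow> int \<Rightarrow> int \<Rightarrow> (int \<Rightarrow> int) set" where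
  "polyhedron a b mu nu =
     {w. (\<forall>q \<le> 0. w q = 0) \<and> w 1 \<le> nu \<and>
         (\<forall>n. alt_rec a b n * w (int n + 2) \<le> alt_rec a b (Suc n) * w (int n + 1)) \<and>
         (\<forall>n. alt_rec b a (Suc n) * w (int n + 2)
                \<le> mu + alt_rec b a (Suc (Suc n)) * w (int n + 1))}"

lemma polyhedronD:
  assumes "w \<in> polyhedron a b mu nu"
  shows "q \<le> 0 \<Longrightarrow> w q = 0" and "w 1 \<le> nu"
    and "alt_rec a b n * w (int n + 2) \<le> alt_rec a b (Suc n) * w (int n + 1)"
    and "alt_rec b a (Suc n) * w (int n + 2)
           \<le> mu + alt_rec b a (Suc (Suc n)) * w (int n + 1)"
  using assms by (simp_all add: polyhedron_def)

text \<open>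
  These two identities are the reason for stability: a gap of absolute value at least \<open>1\<close> compensates
  the change that a step in one coordinate makes to a form, so the form after the step is bounded below
  by a neighbouring form before it.
\<close>

lemma cone_form_Suc:
  "alt_rec a b (Suc (Suc n)) * w (int n + 2) - alt_rec a b (Suc n) * w (int n + 3)
     = (alt_rec a b (Suc n) * w (int n + 1) - alt_rec a b n * w (int n + 2))
       - alt_rec a b (Suc n) * gap a b mu nu w (int n + 1)"
  by (simp add: gap_def algebra_simps)

lemma bound_form_Suc:
  "alt_rec b a (Suc (Suc (Suc n))) * w (int n + 2) - alt_rec b a (Suc (Suc n)) * w (int n + 3)
     = (alt_rec b a (Suc (Suc n)) * w (int n + 1) - alt_rec b a (Suc n) * w (int n + 2))
       - alt_rec b a (Suc (Suc n)) * gap a b mu nu w (int n + 1)"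
  by (simp add: gap_def algebra_simps)

text \<open>
  Only forms with a negative coefficient at \<open>m\<close> can fail after the step.  For these the gap at \<open>m - 2\<close>
  leads back to the preceding form, and the bounds of the weight are the gaps at \<open>-1\<close> and \<open>0\<close>.
  No step takes place at \<open>m \<le> 0\<close>, since the gap at \<open>m - 2\<close> is zero there.
\<close>

lemma polyhedron_raise:
  assumes ab: "a > 0" "b > 0" "a * b \<ge> 4"
    and w: "w \<in> polyhedron a b mu nu" and g: "gap a b mu nu w (m - 2) \<le> - 1"
  shows "w(m := w m + 1) \<in> polyhedron a b mu nu"
proof -
  note D = polyhedronD[OF w]
  have ba: "b * a \<ge> 4" using ab by (simp add: mult.commute)
  note pos = alt_rec_pos[OF ab] alt_rec_pos[OF ab(2,1) ba]
  have m: "m \<ge> 1"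
    using g D(1)[of m] D(1)[of "m - 1"] D(1)[of "m - 2"]
    by (cases "m \<ge> 1") (auto simp: gap_def)
  let ?w = "w(m := w m + 1)"
  have 1: "?w q = 0" if "q \<le> 0" for q
    using that m D(1) by auto
  have 2: "?w 1 \<le> nu"
    using g D(2) D(1)[of "- 1"] D(1)[of 0] by (auto simp: gap_def)
  have 3: "alt_rec a b n * ?w (int n + 2) \<le> alt_rec a b (Suc n) * ?w (int n + 1)" for n
  proof -
    consider "m = int n + 1" | "m = int n + 2" | "m \<noteq> int n + 1" "m \<noteq> int n + 2"
      by blast
    then show ?thesis
    proof cases
      case 1
      then show ?thesis using D(3)[of n] pos(2)[of n] by (simp add: algebra_simps)
    next
      case 2
      show ?thesis
      proof (cases n)
        case (Suc k)
        have "alt_rec a b (Suc k) * gap a b mu nu w (int k + 1) \<le> alt_rec a b (Suc k) * (- 1)"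
          using g 2 Suc pos(2)[of k] by (intro mult_left_mono) (auto simp: add.commute)
        with cone_form_Suc[of a b k w mu nu] D(3)[of k] 2 Suc show ?thesis
          by (simp add: algebra_simps)
      qed (use 2 D(3)[of 0] in simp)
    qed (use D(3) in simp)
  qed
  have 4: "alt_rec b a (Suc n) * ?w (int n + 2) \<le> mu + alt_rec b a (Suc (Suc n)) * ?w (int n + 1)" for n
  proof -
    consider "m = int n + 1" | "m = int n + 2" | "m \<noteq> int n + 1" "m \<noteq> int n + 2"
      by blast
    then show ?thesis
    proof cases
      case 1
      then show ?thesis using D(4)[of n] pos(4)[of "Suc n"] by (simp add: algebra_simps)
    next
      case 2
      show ?thesis
      proof (cases n)
        case 0
        then show ?thesis using g 2 D(1)[of 0] by (simp add: gap_def)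
      next
        case (Suc k)
        have "alt_rec b a (Suc (Suc k)) * gap a b mu nu w (int k + 1) \<le> alt_rec b a (Suc (Suc k)) * (- 1)"
          using g 2 Suc pos(4)[of "Suc k"] by (intro mult_left_mono) (auto simp: add.commute)
        with bound_form_Suc[of b a k w mu nu] D(4)[of k] 2 Suc show ?thesis
          by (simp add: algebra_simps)
      qed
    qed (use D(4) in simp)
  qed
  show ?thesis
    unfolding polyhedron_def using 1 2 3 4 by blast
qed

text \<open>
  Dually, the forms with a positive coefficient at \<open>m\<close> are controlled by the following form through
  the gap at \<open>m\<close>.  A step at \<open>m \<le> 0\<close> would need a positive gap at \<open>0\<close> or \<open>-1\<close>, which the bounds of the
  weight exclude.
\<close>

lemma polyhedron_lower:
  assumes ab: "a > 0" "b > 0" "a * b \<ge> 4"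
    and w: "w \<in> polyhedron a b mu nu" and g: "gap a b mu nu w m \<ge> 1"
  shows "w(m := w m - 1) \<in> polyhedron a b mu nu"
proof -
  note D = polyhedronD[OF w]
  have ba: "b * a \<ge> 4" using ab by (simp add: mult.commute)
  note pos = alt_rec_pos[OF ab] alt_rec_pos[OF ab(2,1) ba]
  have m: "m \<ge> 1"
  proof (rule ccontr)
    assume "\<not> m \<ge> 1"
    then consider "m = 0" | "m = - 1" | "m \<le> - 2" by linarith
    then show False
      by cases (use g D(1) D(2) D(4)[of 0] in \<open>auto simp: gap_def\<close>)
  qed
  let ?w = "w(m := w m - 1)"
  have 1: "?w q = 0" if "q \<le> 0" for q
    using that m D(1) by auto
  have 2: "?w 1 \<le> nu"
    using D(2) by auto
  have 3: "alt_rec a b n * ?w (int n + 2) \<le> alt_rec a b (Suc n) * ?w (int n + 1)" for n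
  proof -
    consider "m = int n + 1" | "m = int n + 2" | "m \<noteq> int n + 1" "m \<noteq> int n + 2"
      by blast
    then show ?thesis
    proof cases
      case 1
      have "alt_rec a b (Suc n) * gap a b mu nu w (int n + 1) \<ge> alt_rec a b (Suc n) * 1"
        using g 1 pos(2)[of n] by (intro mult_left_mono) auto
      with cone_form_Suc[of a b n w mu nu] D(3)[of "Suc n"] 1 show ?thesis
        by (simp add: algebra_simps)
    next
      case 2
      then show ?thesis using D(3)[of n] pos(1)[of n] by (simp add: algebra_simps)
    qed (use D(3) in simp)
  qed
  have 4: "alt_rec b a (Suc n) * ?w (int n + 2) \<le> mu + alt_rec b a (Suc (Suc n)) * ?w (int n + 1)" for n
  proof -
    consider "m = int n + 1" | "m = int n + 2" | "m \<noteq> int n + 1" "m \<noteq> int n + 2"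
      by blast
    then show ?thesis
    proof cases
      case 1
      have "alt_rec b a (Suc (Suc n)) * gap a b mu nu w (int n + 1) \<ge> alt_rec b a (Suc (Suc n)) * 1"
        using g 1 pos(4)[of "Suc n"] by (intro mult_left_mono) auto
      with bound_form_Suc[of b a n w mu nu] D(4)[of "Suc n"] 1 show ?thesis
        by (simp add: algebra_simps)
    next
      case 2
      then show ?thesis using D(4)[of n] pos(4)[of n] by (simp add: algebra_simps)
    qed (use D(4) in simp)
  qed
  show ?thesis
    unfolding polyhedron_def using 1 2 3 4 by blast
qed

text \<open>
  The inequalities of \<open>B(\<infinity>)\<close> propagate nonnegativity downwards, starting beyond the support.
\<close>

lemma polyhedron_nonneg:
  assumes ab: "a > 0" "b > 0" "a * b \<ge> 4"
    and w: "w \<in> polyhedron a b mu nu" and N: "\<And>q. q > int N \<Longrightarrow> w q = 0"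
  shows "w q \<ge> 0"
proof -
  note D = polyhedronD[OF w]
  note pos = alt_rec_pos[OF ab]
  have "w (int n + 1) \<ge> 0" if "n \<le> N" for n
    using that
  proof (induction n rule: inc_induct)
    case base
    then show ?case using N[of "int N + 1"] by simp
  next
    case (step n)
    then have "0 \<le> alt_rec a b n * w (int n + 2)"
      using pos(1)[of n] by (simp add: algebra_simps)
    also have "\<dots> \<le> alt_rec a b (Suc n) * w (int n + 1)"
      by (rule D(3))
    finally show ?case
      using pos(2)[of n] by (simp add: zero_le_mult_iff)
  qed
  from this[of "nat (q - 1)"] N[of q] D(1)[of q] show ?thesis
    by (cases "q \<le> 0"; cases "q > int N") auto
qed

text \<open>
  If the gaps inside the support are nonpositive, the forms of each family increase along the
  support, so the first form of each family decides.  This puts the starting point of the component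
  into the polyhedron.
\<close>

lemma polyhedronI_nonpos_gaps:
  assumes ab: "a > 0" "b > 0" "a * b \<ge> 4" and "mu \<ge> 0"
    and "\<And>q. q \<le> 0 \<Longrightarrow> w q = 0" and j: "\<And>q. q > int j \<Longrightarrow> w q = 0"
    and "0 \<le> w 1" "w 1 \<le> nu"
    and gap: "\<And>q. 0 \<le> q \<Longrightarrow> q < int j \<Longrightarrow> gap a b mu nu w q \<le> 0"
  shows "w \<in> polyhedron a b mu nu"
proof -
  have ba: "b * a \<ge> 4" using ab by (simp add: mult.commute)
  note pos = alt_rec_pos[OF ab] alt_rec_pos[OF ab(2,1) ba]
  have 3: "alt_rec a b n * w (int n + 2) \<le> alt_rec a b (Suc n) * w (int n + 1)" for n
  proof (cases "n < j")
    case True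
    then show ?thesis
    proof (induction n)
      case 0
      then show ?case using assms by simp
    next
      case (Suc n)
      then have "alt_rec a b (Suc n) * gap a b mu nu w (int n + 1) \<le> 0"
        using gap[of "int n + 1"] pos(2)[of n] by (simp add: mult_le_0_iff)
      with Suc cone_form_Suc[of a b n w mu nu] show ?case
        by (simp add: algebra_simps)
    qed
  qed (use j in simp)
  have 4: "alt_rec b a (Suc n) * w (int n + 2) \<le> mu + alt_rec b a (Suc (Suc n)) * w (int n + 1)" for n
  proof (cases "n < j")
    case True
    then show ?thesis
    proof (induction n)
      case 0
      then show ?case using gap[of 0] assms by (simp add: gap_def)
    next
      case (Suc n)
      then have "alt_rec b a (Suc (Suc n)) * gap a b mu nu w (int n + 1) \<le> 0"
        using gap[of "int n + 1"] pos(4)[of "Suc n"] by (simp add: mult_le_0_iff)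
      with Suc bound_form_Suc[of b a n w mu nu] show ?case
        by (simp add: algebra_simps)
    qed
  qed (use j \<open>mu \<ge> 0\<close> in simp)
  show ?thesis
    unfolding polyhedron_def using assms 3 4 by blast
qed

section \<open>Edges of the crystal in terms of gaps\<close>

text \<open>
  The order isomorphism from the integers onto the nonzero integers.  After this renumbering the
  colours alternate across the formal symbol: odd numbers have colour \<open>1\<close>, even ones colour \<open>2\<close>.
\<close>

definition pos :: "int \<Rightarrow> int" where
  "pos p = (if p \<ge> 1 then p else p - 1)"

lemma pos_less_iff [simp]: "pos p < pos q \<longleftrightarrow> p < q"
  and pos_eq_iff [simp]: "pos p = pos q \<longleftrightarrow> p = q"
  and pos_nonzero [simp]: "pos p \<noteq> 0"
  by (auto simp: pos_def)

lemma pos_cases: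
  assumes "k \<noteq> 0"
  obtains p where "k = pos p"
  using that[of "if k > 0 then k else k + 1"] assms by (auto simp: pos_def)

lemma iota_pos: "iota (pos p) = (if odd p then 1 else 2)"
  by (auto simp: iota_def pos_def)

lemma sigma_pos:
  assumes x: "x \<in> Zinf"
  shows "sigma c1 c2 l1 l2 x (pos p) =
           sigma c1 c2 l1 l2 x (pos (p + 2)) + gap c1 c2 l2 l1 (x \<circ> pos) p"
proof -
  define T where "T i k = (\<Sum>j \<in> {j. j > k \<and> j \<noteq> 0 \<and> x j \<noteq> 0}. cartan c1 c2 i (iota j) * x j)" for i k
  have fin: "finite {j. x j \<noteq> 0}" using x by (simp add: Zinf_def)
  have T: "T i (pos p) = cartan c1 c2 i (iota (pos (p + 1))) * x (pos (p + 1)) + T i (pos (p + 1))" for i p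
  proof -
    have "T i (pos p) = (\<Sum>j \<in> insert (pos (p + 1)) {j. j > pos (p + 1) \<and> j \<noteq> 0 \<and> x j \<noteq> 0}.
            cartan c1 c2 i (iota j) * x j)"
      unfolding T_def
    proof (intro sum.mono_neutral_left ballI)
      show "finite (insert (pos (p + 1)) {j. j > pos (p + 1) \<and> j \<noteq> 0 \<and> x j \<noteq> 0})"
        by (auto intro: finite_subset[OF _ fin])
      show "{j. j > pos p \<and> j \<noteq> 0 \<and> x j \<noteq> 0}
              \<subseteq> insert (pos (p + 1)) {j. j > pos (p + 1) \<and> j \<noteq> 0 \<and> x j \<noteq> 0}"
        by (auto simp: pos_def split: if_splits)
    qed (auto simp: pos_def split: if_splits)
    also have "\<dots> = cartan c1 c2 i (iota (pos (p + 1))) * x (pos (p + 1)) + T i (pos (p + 1))"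
      unfolding T_def by (subst sum.insert) (auto intro: finite_subset[OF _ fin])
    finally show ?thesis .
  qed
  have s: "sigma c1 c2 l1 l2 x (pos q) = (if q \<ge> 1 then 0 else - pairing_wt l1 l2 (iota (pos q)))
             + x (pos q) + T (iota (pos q)) (pos q)" for q
    by (simp add: sigma_def T_def pos_def)
  have "iota (pos (p + 2)) = iota (pos p)"
    by (simp add: iota_pos)
  then have "sigma c1 c2 l1 l2 x (pos p) - sigma c1 c2 l1 l2 x (pos (p + 2)) =
      (if p \<ge> 1 then 0 else - pairing_wt l1 l2 (iota (pos p))) + x (pos p)
        + cartan c1 c2 (iota (pos p)) (iota (pos (p + 1))) * x (pos (p + 1))
        + cartan c1 c2 (iota (pos p)) (iota (pos p)) * x (pos (p + 2))
      - ((if p + 2 \<ge> 1 then 0 else - pairing_wt l1 l2 (iota (pos p))) + x (pos (p + 2)))"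
    unfolding s T[of _ p] T[of _ "p + 1"] by (simp add: add.assoc)
  also have "\<dots> = gap c1 c2 l2 l1 (x \<circ> pos) p"
  proof -
    consider "p \<ge> 1" | "p = 0" | "p = - 1" | "p \<le> - 2" by linarith
    then show ?thesis
      by cases (auto simp: gap_def iota_pos cartan_def pairing_wt_def)
  qed
  finally show ?thesis by simp
qed

lemma sigma_eventually_0:
  assumes "x \<in> Zinf"
  shows "\<exists>N. \<forall>k \<ge> N. sigma c1 c2 l1 l2 x k = 0"
proof -
  have fin: "finite {j. x j \<noteq> 0}" using assms by (simp add: Zinf_def)
  then obtain N where N: "\<And>j. x j \<noteq> 0 \<Longrightarrow> j \<le> N"
    using bdd_above_finite[OF fin] by (auto simp: bdd_above_def)
  have "sigma c1 c2 l1 l2 x k = 0" if "k \<ge> max 1 (N + 1)" for k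
  proof -
    have "x k = 0" and "{j. j > k \<and> j \<noteq> 0 \<and> x j \<noteq> 0} = {}"
      using that N by force+
    with that show ?thesis by (simp add: sigma_def)
  qed
  then show ?thesis by blast
qed

text \<open>Summing the gaps of one colour upwards gives \<open>\<sigma>\<close>, since \<open>\<sigma>\<close> vanishes far to the left.\<close>

lemma sigma_sign:
  assumes x: "x \<in> Zinf"
  shows "(\<And>q. q \<ge> p \<Longrightarrow> gap c1 c2 l2 l1 (x \<circ> pos) q \<le> 0) \<Longrightarrow> sigma c1 c2 l1 l2 x (pos p) \<le> 0"
    and "(\<And>q. q \<ge> p \<Longrightarrow> gap c1 c2 l2 l1 (x \<circ> pos) q \<ge> 0) \<Longrightarrow> sigma c1 c2 l1 l2 x (pos p) \<ge> 0"
proof -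
  let ?s = "\<lambda>p. sigma c1 c2 l1 l2 x (pos p)"
  obtain N where N: "\<And>k. k \<ge> N \<Longrightarrow> sigma c1 c2 l1 l2 x k = 0"
    using sigma_eventually_0[OF x] by blast
  have z: "?s (p + 2 * int n) = 0" if "n = nat (\<bar>N\<bar> + \<bar>p\<bar>) + 1" for n
    using that by (intro N) (auto simp: pos_def)
  have step: "?s (p + 2 * int n) = ?s (p + 2 * int (Suc n)) + gap c1 c2 l2 l1 (x \<circ> pos) (p + 2 * int n)" for n
    using sigma_pos[OF x, of c1 c2 l1 l2 "p + 2 * int n"] by (simp add: algebra_simps)
  show "?s p \<le> 0" if g: "\<And>q. q \<ge> p \<Longrightarrow> gap c1 c2 l2 l1 (x \<circ> pos) q \<le> 0"
  proof -
    have "?s p \<le> ?s (p + 2 * int n)" for n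
    proof (induction n)
      case (Suc n)
      then show ?case using step[of n] g[of "p + 2 * int n"] by linarith
    qed simp
    then show ?thesis using z by metis
  qed
  show "?s p \<ge> 0" if g: "\<And>q. q \<ge> p \<Longrightarrow> gap c1 c2 l2 l1 (x \<circ> pos) q \<ge> 0"
  proof -
    have "?s p \<ge> ?s (p + 2 * int n)" for n
    proof (induction n)
      case (Suc n)
      then show ?case using step[of n] g[of "p + 2 * int n"] by linarith
    qed simp
    then show ?thesis using z by metis
  qed
qed

lemma sigma_le_sigma_max:
  assumes "x \<in> Zinf" "k \<noteq> 0"
  shows "sigma c1 c2 l1 l2 x k \<le> sigma_max c1 c2 l1 l2 (iota k) x"
  unfolding sigma_max_def using assms by (intro Max_ge finite_sigma_values) auto

lemma sigma_max_attained:
  assumes x: "x \<in> Zinf" and i: "i \<in> {1, 2}"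
  shows "\<exists>k. k \<noteq> 0 \<and> iota k = i \<and> sigma c1 c2 l1 l2 x k = sigma_max c1 c2 l1 l2 i x"
proof -
  have "(if i = 1 then 1 else 2 :: int) \<noteq> 0 \<and> iota (if i = 1 then 1 else 2) = i"
    using i by (auto simp: iota_def)
  then have "{sigma c1 c2 l1 l2 x k |k. k \<noteq> 0 \<and> iota k = i} \<noteq> {}"
    by blast
  from Max_in[OF finite_sigma_values[OF x] this] show ?thesis
    unfolding sigma_max_def by auto
qed

text \<open>
  The value \<open>0\<close> is attained at arbitrarily large positions of each colour, so the maximum of \<open>\<sigma>\<close> is
  never negative, and the set where it is attained is bounded above exactly if the maximum is positive.
\<close>

lemma e_op_None_iff:
  assumes x: "x \<in> Zinf" and i: "i \<in> {1, 2}"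
  shows "e_op c1 c2 l1 l2 i x = None
           \<longleftrightarrow> (\<forall>p. iota (pos p) = i \<longrightarrow> sigma c1 c2 l1 l2 x (pos p) \<le> 0)"
proof -
  let ?s = "sigma c1 c2 l1 l2 x" and ?M = "M_set c1 c2 l1 l2 i x"
  let ?mx = "sigma_max c1 c2 l1 l2 i x"
  obtain N where N: "\<And>k. k \<ge> N \<Longrightarrow> ?s k = 0"
    using sigma_eventually_0[OF x] by blast
  have large: "\<exists>k > n. k \<noteq> 0 \<and> iota k = i \<and> ?s k = 0" for n
  proof (intro exI conjI)
    let ?k = "2 * (\<bar>n\<bar> + \<bar>N\<bar> + 1) + (if i = 1 then 1 else 0)"
    show "?k > n" "?k \<noteq> 0" "?s ?k = 0" by (auto intro!: N)
    show "iota ?k = i" using i by (auto simp: iota_def)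
  qed
  have ge: "?mx \<ge> 0"
    using large[of 0] sigma_le_sigma_max[OF x, of _ c1 c2 l1 l2] by metis
  obtain k0 where k0: "k0 \<in> ?M"
    using sigma_max_attained[OF x i, of c1 c2 l1 l2] by (auto simp: M_set_def)
  have "(\<exists>m\<in>?M. \<forall>k\<in>?M. k \<le> m) \<longleftrightarrow> ?mx > 0"
  proof
    assume "\<exists>m\<in>?M. \<forall>k\<in>?M. k \<le> m"
    then obtain m where m: "\<And>k. k \<in> ?M \<Longrightarrow> k \<le> m" by blast
    show "?mx > 0"
    proof (rule ccontr)
      assume "\<not> ?mx > 0"
      with ge have "?mx = 0" by simp
      with large[of m] m show False by (force simp: M_set_def)
    qed
  next
    assume p: "?mx > 0"
    have lt: "k < N" if "k \<in> ?M" for k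
      using N[of k] p that by (force simp: M_set_def)
    define S where "S = {k \<in> ?M. k \<ge> k0}"
    have "finite S"
      unfolding S_def by (rule finite_subset[of _ "{k0..N}"]) (auto dest: lt)
    moreover have "k0 \<in> S" using k0 by (simp add: S_def)
    ultimately have "Max S \<in> S" and le: "\<And>k. k \<in> S \<Longrightarrow> k \<le> Max S"
      by (auto intro: Max_in)
    then have M: "Max S \<in> ?M" "Max S \<ge> k0" by (auto simp: S_def)
    moreover have "k \<le> Max S" if "k \<in> ?M" for k
      using le[of k] that M(2) by (cases "k \<ge> k0") (auto simp: S_def)
    ultimately show "\<exists>m\<in>?M. \<forall>k\<in>?M. k \<le> m" by blast
  qed
  then have "e_op c1 c2 l1 l2 i x = None \<longleftrightarrow> ?mx \<le> 0"
    by (auto simp: e_op_def Let_def)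
  also have "\<dots> \<longleftrightarrow> (\<forall>p. iota (pos p) = i \<longrightarrow> ?s (pos p) \<le> 0)"
  proof
    assume "?mx \<le> 0"
    then show "\<forall>p. iota (pos p) = i \<longrightarrow> ?s (pos p) \<le> 0"
      using sigma_le_sigma_max[OF x, of _ c1 c2 l1 l2] by (metis order_trans pos_nonzero)
  next
    assume "\<forall>p. iota (pos p) = i \<longrightarrow> ?s (pos p) \<le> 0"
    then show "?mx \<le> 0"
      using sigma_max_attained[OF x i, of c1 c2 l1 l2] by (metis pos_cases)
  qed
  finally show ?thesis .
qed

lemma gap_raise:
  "gap a b mu nu (w(p := w p + d)) p = gap a b mu nu w p + d"
  "gap a b mu nu (w(p := w p + d)) (p - 2) = gap a b mu nu w (p - 2) + d"
  by (simp_all add: gap_def)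

lemma fun_upd_comp_pos: "x(pos p := v) \<circ> pos = (x \<circ> pos)(p := v)"
  by (auto simp: fun_eq_iff)

lemma e_op_SomeD:
  assumes x: "x \<in> Zinf" and e: "e_op c1 c2 l1 l2 i x = Some y"
  shows "\<exists>p. y = x(pos p := x (pos p) - 1) \<and> gap c1 c2 l2 l1 (x \<circ> pos) p \<ge> 1
           \<and> gap c1 c2 l2 l1 (x \<circ> pos) (p - 2) \<le> 0"
proof -
  let ?M = "M_set c1 c2 l1 l2 i x"
  from e obtain m where m: "m \<in> ?M" "\<And>k. k \<in> ?M \<Longrightarrow> k \<le> m"
    and y: "y = (let m = (GREATEST k. k \<in> ?M) in x(m := x m - 1))"
    by (auto simp: e_op_def Let_def split: if_splits)
  have "(GREATEST k. k \<in> ?M) = m"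
    using m by (intro Greatest_equality)
  with y have y: "y = x(m := x m - 1)" by simp
  obtain p where p: "m = pos p"
    using m by (auto simp: M_set_def intro: pos_cases)
  have i: "iota (pos p) = i" "iota (pos (p + 2)) = i" "iota (pos (p - 2)) = i"
    using m(1) by (auto simp: M_set_def p iota_pos)
  have mx: "sigma c1 c2 l1 l2 x (pos p) = sigma_max c1 c2 l1 l2 i x"
    using m(1) by (simp add: M_set_def p)
  have "pos (p + 2) \<notin> ?M"
    using m(2)[of "pos (p + 2)"] pos_less_iff[of p "p + 2"] p by linarith
  then have "sigma c1 c2 l1 l2 x (pos (p + 2)) \<noteq> sigma c1 c2 l1 l2 x (pos p)"
    using i mx by (auto simp: M_set_def)
  moreover have "sigma c1 c2 l1 l2 x (pos (p + 2)) \<le> sigma c1 c2 l1 l2 x (pos p)"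
    using sigma_le_sigma_max[OF x, of "pos (p + 2)" c1 c2 l1 l2] i mx by simp
  moreover have "sigma c1 c2 l1 l2 x (pos (p - 2)) \<le> sigma c1 c2 l1 l2 x (pos p)"
    using sigma_le_sigma_max[OF x, of "pos (p - 2)" c1 c2 l1 l2] i mx by simp
  ultimately show ?thesis
    using sigma_pos[OF x, of c1 c2 l1 l2 p] sigma_pos[OF x, of c1 c2 l1 l2 "p - 2"] y p
    by (intro exI[of _ p]) auto
qed

lemma f_op_SomeD:
  assumes x: "x \<in> Zinf" and e: "f_op c1 c2 l1 l2 i x = Some y"
  shows "\<exists>p. y = x(pos p := x (pos p) + 1) \<and> gap c1 c2 l2 l1 (x \<circ> pos) p \<ge> 0
           \<and> gap c1 c2 l2 l1 (x \<circ> pos) (p - 2) \<le> - 1"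
proof -
  let ?M = "M_set c1 c2 l1 l2 i x"
  from e obtain m where m: "m \<in> ?M" "\<And>k. k \<in> ?M \<Longrightarrow> m \<le> k"
    and y: "y = (let m = (LEAST k. k \<in> ?M) in x(m := x m + 1))"
    by (auto simp: f_op_def Let_def split: if_splits)
  have "(LEAST k. k \<in> ?M) = m"
    using m by (intro Least_equality)
  with y have y: "y = x(m := x m + 1)" by simp
  obtain p where p: "m = pos p"
    using m by (auto simp: M_set_def intro: pos_cases)
  have i: "iota (pos p) = i" "iota (pos (p + 2)) = i" "iota (pos (p - 2)) = i"
    using m(1) by (auto simp: M_set_def p iota_pos)
  have mx: "sigma c1 c2 l1 l2 x (pos p) = sigma_max c1 c2 l1 l2 i x"
    using m(1) by (simp add: M_set_def p)
  have "pos (p - 2) \<notin> ?M"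
    using m(2)[of "pos (p - 2)"] pos_less_iff[of "p - 2" p] p by linarith
  then have "sigma c1 c2 l1 l2 x (pos (p - 2)) \<noteq> sigma c1 c2 l1 l2 x (pos p)"
    using i mx by (auto simp: M_set_def)
  moreover have "sigma c1 c2 l1 l2 x (pos (p + 2)) \<le> sigma c1 c2 l1 l2 x (pos p)"
    using sigma_le_sigma_max[OF x, of "pos (p + 2)" c1 c2 l1 l2] i mx by simp
  moreover have "sigma c1 c2 l1 l2 x (pos (p - 2)) \<le> sigma c1 c2 l1 l2 x (pos p)"
    using sigma_le_sigma_max[OF x, of "pos (p - 2)" c1 c2 l1 l2] i mx by simp
  ultimately show ?thesis
    using sigma_pos[OF x, of c1 c2 l1 l2 p] sigma_pos[OF x, of c1 c2 l1 l2 "p - 2"] y p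
    by (intro exI[of _ p]) auto
qed

text \<open>
  A step that increases one coordinate, together with the only consequences of the maximality of
  \<open>\<sigma>\<close> that are needed: the gap two positions below before the step, and the gap at
  the position itself after it.  Both operators lead to this relation, \<open>f\<^sub>i\<close> forwards and \<open>e\<^sub>i\<close>
  backwards, which makes it suitable for components, where edges may be followed in either direction.
\<close>

definition raises :: "int \<Rightarrow> int \<Rightarrow> int \<Rightarrow> int \<Rightarrow> int \<Rightarrow> (int \<Rightarrow> int) \<Rightarrow> (int \<Rightarrow> int) \<Rightarrow> bool" where
  "raises c1 c2 l1 l2 p x y \<longleftrightarrow> y = x(pos p := x (pos p) + 1) \<and>
     gap c1 c2 l2 l1 (x \<circ> pos) (p - 2) \<le> - 1 \<and> gap c1 c2 l2 l1 (y \<circ> pos) p \<ge> 1"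

lemma e_op_raises:
  assumes "x \<in> Zinf" "e_op c1 c2 l1 l2 i x = Some y"
  shows "\<exists>p. raises c1 c2 l1 l2 p y x"
proof -
  obtain p where p: "y = x(pos p := x (pos p) - 1)" "gap c1 c2 l2 l1 (x \<circ> pos) p \<ge> 1"
      "gap c1 c2 l2 l1 (x \<circ> pos) (p - 2) \<le> 0"
    using e_op_SomeD[OF assms] by blast
  have "x = y(pos p := y (pos p) + 1)" using p(1) by auto
  moreover have "gap c1 c2 l2 l1 (y \<circ> pos) (p - 2) = gap c1 c2 l2 l1 (x \<circ> pos) (p - 2) - 1"
    using gap_raise(2)[of c1 c2 l2 l1 "x \<circ> pos" p "- 1"] by (simp add: p(1) fun_upd_comp_pos)
  ultimately show ?thesis using p unfolding raises_def by (intro exI[of _ p]) linarith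
qed

lemma f_op_raises:
  assumes "x \<in> Zinf" "f_op c1 c2 l1 l2 i x = Some y"
  shows "\<exists>p. raises c1 c2 l1 l2 p x y"
proof -
  obtain p where p: "y = x(pos p := x (pos p) + 1)" "gap c1 c2 l2 l1 (x \<circ> pos) p \<ge> 0"
      "gap c1 c2 l2 l1 (x \<circ> pos) (p - 2) \<le> - 1"
    using f_op_SomeD[OF assms] by blast
  moreover have "gap c1 c2 l2 l1 (y \<circ> pos) p = gap c1 c2 l2 l1 (x \<circ> pos) p + 1"
    using gap_raise(1)[of c1 c2 l2 l1 "x \<circ> pos" p 1] by (simp add: p(1) fun_upd_comp_pos)
  ultimately show ?thesis unfolding raises_def by (intro exI[of _ p]) linarith
qed

lemma crystal_edges_raises:
  assumes "(x, y) \<in> crystal_edges c1 c2 l1 l2"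
  shows "\<exists>p. raises c1 c2 l1 l2 p x y \<or> raises c1 c2 l1 l2 p y x"
  using assms e_op_raises[of x] f_op_raises[of x] by (auto simp: crystal_edges_def) metis+

section \<open>Coordinates relative to the vector \<open>H\<^bsub>-j\<^esub>\<close>\<close>

text \<open>
  The number \<open>h\<^bsub>-j\<^esub>\<close> combines \<open>a\<close> for even and \<open>a'\<close> for odd \<open>j\<close>, so its recurrence mixes the two
  sequences.  They agree at odd indices and are proportional at even ones.
\<close>

lemma alt_rec_swap:
  "(odd n \<longrightarrow> alt_rec b a n = alt_rec a b n) \<and> (even n \<longrightarrow> a * alt_rec b a n = b * alt_rec a b n)"
  by (induction a b n rule: alt_rec.induct) (auto simp: algebra_simps)

lemma alt_rec_swap_rec:
  "alt_rec a b (Suc (Suc n)) = a * alt_rec b a (Suc n) - alt_rec a b n"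
  using alt_rec_swap[of "Suc n" a b] by auto

lemma h_coord_1: "h_coord c1 c2 l1 l2 (Suc 0) = l2"
  and h_coord_2: "h_coord c1 c2 l1 l2 (Suc (Suc 0)) = l1 + c1 * l2"
  by (simp_all add: h_coord_def a_seq_eq_alt_rec a'_seq_eq_alt_rec)

lemma h_coord_rec:
  "h_coord c1 c2 l1 l2 (Suc (Suc (Suc n))) =
     (if even n then c2 else c1) * h_coord c1 c2 l1 l2 (Suc (Suc n)) - h_coord c1 c2 l1 l2 (Suc n)"
  by (simp add: h_coord_def a_seq_eq_alt_rec a'_seq_eq_alt_rec alt_rec_swap_rec[of _ _ n]
      alt_rec_swap_rec[of _ _ "Suc n"] algebra_simps del: alt_rec.simps(3))

lemma H_vec_pos:
  "H_vec c1 c2 l1 l2 j (pos p) = (if 1 - int j \<le> p \<and> p \<le> 0 then h_coord c1 c2 l1 l2 (nat (1 - p)) else 0)"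
  by (auto simp: H_vec_def pos_def)

text \<open>
  The three-term recurrence of the numbers \<open>h\<^bsub>-n\<^esub>\<close> makes the gaps of \<open>H\<^bsub>-j\<^esub>\<close> vanish, also at the
  seam, where \<open>h\<^bsub>-1\<^esub> = \<lambda>\<^sub>2\<close> and \<open>h\<^bsub>-2\<^esub> = \<lambda>\<^sub>1 + c\<^sub>1\<lambda>\<^sub>2\<close> absorb the weight.  Truncation
  after \<open>j\<close> terms leaves two nonzero gaps.
\<close>

lemma gap_H_vec:
  assumes j: "j \<ge> 1"
  shows "gap c1 c2 l2 l1 (H_vec c1 c2 l1 l2 j \<circ> pos) p =
     - (if p = - int j then h_coord c1 c2 l1 l2 (Suc j)
        else if p = - int j - 1 then - h_coord c1 c2 l1 l2 j else 0)"
proof -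
  consider "p \<ge> 1" | "p = 0" | "p = - 1" | n where "p = - 2 - int n"
  proof -
    have "p = - 2 - int (nat (- 2 - p))" if "p \<le> - 2" using that by simp
    then show ?thesis using that by fastforce
  qed
  then show ?thesis
  proof cases
    case 1
    then show ?thesis using j by (simp add: gap_def H_vec_pos)
  next
    case 2
    then show ?thesis using j by (simp add: gap_def H_vec_pos h_coord_1)
  next
    case 3
    then show ?thesis
      using j h_coord_1[of c1 c2 l1 l2] h_coord_2[of c1 c2 l1 l2]
      by (cases "j = 1") (auto simp: gap_def H_vec_pos numeral_2_eq_2 nat_eq_iff)
  next
    case 4
    have n: "nat (1 - p) = Suc (Suc (Suc n))" "nat (1 - (p + 1)) = Suc (Suc n)"
        "nat (1 - (p + 2)) = Suc n"
      using 4 by auto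
    let ?H = "H_vec c1 c2 l1 l2 j" and ?h = "h_coord c1 c2 l1 l2"
    have H: "?H (pos p) = (if n + 3 \<le> j then ?h (Suc (Suc (Suc n))) else 0)"
        "?H (pos (p + 1)) = (if n + 2 \<le> j then ?h (Suc (Suc n)) else 0)"
        "?H (pos (p + 2)) = (if n + 1 \<le> j then ?h (Suc n) else 0)"
      unfolding H_vec_pos n using 4 by auto
    have p: "p = - int j \<longleftrightarrow> j = n + 2" "p = - int j - 1 \<longleftrightarrow> j = n + 1" "p \<noteq> 0" "p \<noteq> - 1"
      using 4 by auto
    have odd: "odd p \<longleftrightarrow> odd n" using 4 by simp
    consider "j \<ge> n + 3" | "j = n + 2" | "j = n + 1" | "j < n + 1" by linarith
    then show ?thesis
      unfolding gap_def comp_def H p if_not_P[OF p(3)] if_not_P[OF p(4)] odd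
      by cases (simp_all add: h_coord_rec)
  qed
qed

text \<open>
  Coordinates in which \<open>H\<^bsub>-j\<^esub>\<close> is the zero sequence, renumbered so that the formal symbol, moved past
  \<open>j\<close> positions, again sits between \<open>0\<close> and \<open>1\<close>.
\<close>

definition rel_coord :: "int \<Rightarrow> int \<Rightarrow> int \<Rightarrow> int \<Rightarrow> nat \<Rightarrow> (int \<Rightarrow> int) \<Rightarrow> int \<Rightarrow> int" where
  "rel_coord c1 c2 l1 l2 j x q = x (pos (q - int j)) - H_vec c1 c2 l1 l2 j (pos (q - int j))"

text \<open>
  The crystal isomorphism that moves \<open>t\<^sub>\<lambda>\<close> past \<open>j\<close> factors.  The Cartan entries are exchanged for odd
  \<open>j\<close> because the renumbering then exchanges the colours.
\<close>

lemma gap_rel_coord: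
  assumes j: "j \<ge> 1" and ab: "(a, b) = (if odd j then (c2, c1) else (c1, c2))"
  shows "gap c1 c2 l2 l1 (x \<circ> pos) p =
           gap a b (h_coord c1 c2 l1 l2 (Suc j)) (- h_coord c1 c2 l1 l2 j)
             (rel_coord c1 c2 l1 l2 j x) (p + int j)"
proof -
  let ?H = "H_vec c1 c2 l1 l2 j" and ?c = "if odd p then c1 else c2"
  have "gap c1 c2 l2 l1 (x \<circ> pos) p = gap c1 c2 l2 l1 (?H \<circ> pos) p
          + (x (pos p) - ?H (pos p)) + (x (pos (p + 2)) - ?H (pos (p + 2)))
          - ?c * (x (pos (p + 1)) - ?H (pos (p + 1)))"
    by (simp add: gap_def algebra_simps)
  also have "\<dots> = gap a b (h_coord c1 c2 l1 l2 (Suc j)) (- h_coord c1 c2 l1 l2 j)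
             (rel_coord c1 c2 l1 l2 j x) (p + int j)"
  proof -
    have "?c = (if odd (p + int j) then a else b)"
      using ab by (auto split: if_splits)
    moreover have "p + int j + 1 - int j = p + 1" "p + int j + 2 - int j = p + 2" by simp_all
    ultimately show ?thesis
      unfolding gap_H_vec[OF j] gap_def[of a b] rel_coord_def by (auto simp: algebra_simps)
  qed
  finally show ?thesis .
qed

section \<open>The component of the zero sequence\<close>

lemma sum_support_le:
  assumes x: "x \<in> Zinf" and y: "y \<in> Zinf" and le: "\<And>k. x k \<le> y k"
  shows "sum x {k. x k \<noteq> 0} \<le> sum y {k. y k \<noteq> 0}"
proof -
  have fin: "finite {k. x k \<noteq> 0}" "finite {k. y k \<noteq> 0}"
    using x y by (auto simp: Zinf_def)
  let ?F = "{k. x k \<noteq> 0} \<union> {k. y k \<noteq> 0}"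
  have "sum x {k. x k \<noteq> 0} = sum x ?F" "sum y {k. y k \<noteq> 0} = sum y ?F"
    using fin by (auto intro!: sum.mono_neutral_left)
  then show ?thesis using le by (simp add: sum_mono)
qed

lemma sum_support_upd:
  assumes x: "x \<in> Zinf"
  shows "sum (x(k := x k + d)) {i. (x(k := x k + d)) i \<noteq> 0} = sum x {i. x i \<noteq> 0} + d"
proof -
  have fin: "finite {k. x k \<noteq> 0}"
    using x by (auto simp: Zinf_def)
  let ?F = "insert k {k. x k \<noteq> 0}" and ?y = "x(k := x k + d)"
  have "sum ?y {i. ?y i \<noteq> 0} = sum ?y ?F"
    using fin by (intro sum.mono_neutral_left) auto
  also have "\<dots> = ?y k + sum ?y (?F - {k})"
    using fin by (subst sum.remove[of _ k]) auto
  also have "sum ?y (?F - {k}) = sum x (?F - {k})"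
    by (intro sum.cong) auto
  also have "?y k + sum x (?F - {k}) = sum x ?F + d"
    using fin by (subst (2) sum.remove[of _ k]) auto
  also have "sum x ?F = sum x {i. x i \<noteq> 0}"
    using fin by (intro sum.mono_neutral_right) auto
  finally show ?thesis .
qed

lemma Zinf_upd: "x \<in> Zinf \<Longrightarrow> x(pos p := v) \<in> Zinf"
  by (auto simp: Zinf_def intro: finite_subset[of _ "insert (pos p) {k. x k \<noteq> 0}"])

text \<open>
  The hypotheses on \<open>h\<^bsub>-j\<^esub>\<close> and \<open>h\<^bsub>-j-1\<^esub>\<close> are the dominance of the reflected weight.
\<close>

lemma highest_weight_vectors_B0:
  assumes c: "c1 > 0" "c2 > 0" "c1 * c2 \<ge> 4" and l: "l1 > 0" "l2 < 0" and j: "j \<ge> 1"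
    and nu: "h_coord c1 c2 l1 l2 j \<le> 0" and mu: "h_coord c1 c2 l1 l2 (Suc j) \<ge> 0"
  shows "highest_weight_vectors c1 c2 l1 l2 (B0 c1 c2 l1 l2) = {H_vec c1 c2 l1 l2 j}"
proof -
  define H where "H = H_vec c1 c2 l1 l2 j"
  define a b where "a = (if odd j then c2 else c1)" and "b = (if odd j then c1 else c2)"
  have ab: "a > 0" "b > 0" "a * b \<ge> 4" and ab_eq: "(a, b) = (if odd j then (c2, c1) else (c1, c2))"
    using c by (auto simp: a_def b_def mult.commute)
  let ?P = "polyhedron a b (h_coord c1 c2 l1 l2 (Suc j)) (- h_coord c1 c2 l1 l2 j)"
  let ?gap = "gap a b (h_coord c1 c2 l1 l2 (Suc j)) (- h_coord c1 c2 l1 l2 j)"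
  let ?w = "rel_coord c1 c2 l1 l2 j"
  let ?E = "crystal_edges c1 c2 l1 l2"
  note gap_w = gap_rel_coord[OF j ab_eq, of l2 l1]
  have w_upd: "?w (x(pos p := x (pos p) + d)) = (?w x)(p + int j := ?w x (p + int j) + d)" for x p d
  proof
    show "?w (x(pos p := x (pos p) + d)) q = ((?w x)(p + int j := ?w x (p + int j) + d)) q" for q
      by (cases "q = p + int j") (simp_all add: rel_coord_def diff_eq_eq)
  qed
  have raises: "?w x \<in> ?P \<longleftrightarrow> ?w y \<in> ?P" if "raises c1 c2 l1 l2 p x y" for p x y
  proof -
    let ?m = "p + int j"
    have y: "y = x(pos p := x (pos p) + 1)" and x: "x = y(pos p := y (pos p) + (- 1))"
      using that by (auto simp: raises_def)
    have "p - 2 + int j = ?m - 2" by simp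
    then have g: "?gap (?w x) (?m - 2) \<le> - 1" "?gap (?w y) ?m \<ge> 1"
      using that gap_w[of x "p - 2"] gap_w[of y p] unfolding raises_def \<open>p - 2 + int j = ?m - 2\<close>
      by linarith+
    have "?w y = (?w x)(?m := ?w x ?m + 1)" "?w x = (?w y)(?m := ?w y ?m - 1)"
      using w_upd[of x p 1] w_upd[of y p "- 1"] unfolding y[symmetric] x[symmetric] by simp_all
    then show ?thesis
      using polyhedron_raise[OF ab _ g(1)] polyhedron_lower[OF ab _ g(2)] by auto
  qed
  \<comment> \<open>The gaps of the original zero sequence are \<open>-l1\<close> at \<open>-1\<close>, \<open>-l2\<close> at \<open>0\<close> and zero elsewhere.  The
     second one is positive, but it lands at \<open>q = j\<close>, just outside the range in which gaps are tested.\<close>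
  have w_zero: "?w (\<lambda>_. 0) q = (if 1 \<le> q \<and> q \<le> int j then - h_coord c1 c2 l1 l2 (nat (int j + 1 - q)) else 0)" for q
  proof -
    have eq: "1 - (q - int j) = int j + 1 - q" by simp
    show ?thesis unfolding rel_coord_def H_vec_pos eq by auto
  qed
  have zero: "?w (\<lambda>_. 0) \<in> ?P"
  proof (rule polyhedronI_nonpos_gaps[OF ab, where j = j])
    show "?gap (?w (\<lambda>_. 0)) q \<le> 0" if "0 \<le> q" "q < int j" for q
    proof -
      have "gap c1 c2 l2 l1 ((\<lambda>_. 0) \<circ> pos) (q - int j) \<le> 0"
        using that l by (simp add: gap_def)
      then show ?thesis using gap_w[of "\<lambda>_. 0" "q - int j"] by simp
    qed
    show "0 \<le> ?w (\<lambda>_. 0) 1" "?w (\<lambda>_. 0) 1 \<le> - h_coord c1 c2 l1 l2 j"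
      using j nu by (simp_all add: w_zero)
  qed (simp_all add: w_zero mu)
  have B0: "x \<in> Zinf \<and> ?w x \<in> ?P" if "x \<in> B0 c1 c2 l1 l2" for x
  proof -
    have "(\<lambda>_. 0, x) \<in> (?E \<union> ?E\<inverse>)\<^sup>*" using that by (simp add: B0_def)
    then show ?thesis
    proof (induction rule: rtrancl_induct)
      case base
      show ?case using zero by (simp add: Zinf_def)
    next
      case (step x y)
      then have "y \<in> Zinf" by (auto simp: crystal_edges_def)
      moreover have "\<exists>p. raises c1 c2 l1 l2 p x y \<or> raises c1 c2 l1 l2 p y x"
        using step(2) crystal_edges_raises by blast
      ultimately show ?case using step.IH raises by blast
    qed
  qed
  have w_nonneg: "?w x q \<ge> 0" and w_supp: "\<exists>N. \<forall>q > int N. ?w x q = 0"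
    if x: "x \<in> Zinf" "?w x \<in> ?P" for x q
  proof -
    have "finite {k. x k \<noteq> 0}" using x by (simp add: Zinf_def)
    then obtain K where K: "\<And>k. x k \<noteq> 0 \<Longrightarrow> k \<le> K"
      using bdd_above_finite[of "{k. x k \<noteq> 0}"] by (auto simp: bdd_above_def)
    have z: "?w x q = 0" if "q > int (nat \<bar>K\<bar> + j)" for q
    proof -
      have "q - int j > K" "q - int j \<ge> 1" using that by linarith+
      then have "pos (q - int j) > K" by (simp add: pos_def)
      then have "x (pos (q - int j)) = 0" using K[of "pos (q - int j)"] by fastforce
      then show ?thesis using \<open>q - int j \<ge> 1\<close> by (simp add: rel_coord_def H_vec_pos)
    qed
    then show "\<exists>N. \<forall>q > int N. ?w x q = 0" by blast
    show "?w x q \<ge> 0"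
      using polyhedron_nonneg[OF ab x(2) z] .
  qed
  have H_Zinf: "H \<in> Zinf"
    by (auto simp: Zinf_def H_def H_vec_def intro: finite_subset[of _ "{- int j .. - 1}"])
  have H_le: "H k \<le> x k" if x: "x \<in> Zinf" "?w x \<in> ?P" for x k
  proof (cases "k = 0")
    case True
    then show ?thesis using x(1) H_Zinf by (simp add: Zinf_def)
  next
    case False
    then obtain p where "k = pos p" by (rule pos_cases)
    then show ?thesis using w_nonneg[OF x, of "p + int j"] by (simp add: rel_coord_def H_def)
  qed
  have hw_H: "\<forall>i\<in>{1, 2}. e_op c1 c2 l1 l2 i H = None"
  proof -
    have "sigma c1 c2 l1 l2 H (pos p) \<le> 0" for p
      using nu mu by (intro sigma_sign(1)[OF H_Zinf]) (simp add: H_def gap_H_vec[OF j])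
    then show ?thesis using e_op_None_iff[OF H_Zinf] by simp
  qed
  have unique: "x = H"
    if x: "x \<in> Zinf" "?w x \<in> ?P" and hw: "\<forall>i\<in>{1, 2}. e_op c1 c2 l1 l2 i x = None" for x
  proof (rule ccontr)
    assume "x \<noteq> H"
    then obtain k where k: "x k \<noteq> H k" by auto
    then have "k \<noteq> 0" using x(1) H_Zinf by (auto simp: Zinf_def)
    then obtain p0 where "k = pos p0" by (rule pos_cases)
    with k have q0: "?w x (p0 + int j) \<noteq> 0" by (simp add: rel_coord_def H_def)
    \<comment> \<open>At the last nonzero relative coordinate the gap equals this coordinate, and all later
       gaps vanish.\<close>
    define Q where "Q = {q. q \<ge> 1 \<and> ?w x q \<noteq> 0}"
    define q where "q = Max Q"
    obtain N where N: "\<And>q. q > int N \<Longrightarrow> ?w x q = 0" using w_supp[OF x] by blast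
    have fin: "finite Q"
      unfolding Q_def by (rule finite_subset[of _ "{1..int N}"]) (use N in force)+
    have "p0 + int j \<in> Q"
      using q0 polyhedronD(1)[OF x(2), of "p0 + int j"] unfolding Q_def by force
    then have "q \<in> Q" unfolding q_def using fin by (intro Max_in) auto
    then have q: "q \<ge> 1" "?w x q \<noteq> 0" by (auto simp: Q_def)
    have q_last: "?w x q' = 0" if "q' > q" for q'
    proof (rule ccontr)
      assume "?w x q' \<noteq> 0"
      then have "q' \<in> Q" using that q(1) by (simp add: Q_def)
      then have "q' \<le> q" unfolding q_def using fin by (rule Max_ge[rotated])
      then show False using that by simp
    qed
    have g: "gap c1 c2 l2 l1 (x \<circ> pos) (p - int j) = (if p = q then ?w x q else 0)" if "p \<ge> q" for p
    proof -
      have "gap c1 c2 l2 l1 (x \<circ> pos) (p - int j) = ?gap (?w x) p"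
        using gap_w[of x "p - int j"] by simp
      also have "\<dots> = ?w x p"
        using that q(1) q_last[of "p + 1"] q_last[of "p + 2"] by (simp add: gap_def)
      also have "\<dots> = (if p = q then ?w x q else 0)"
        using that q_last[of p] by simp
      finally show ?thesis .
    qed
    have "gap c1 c2 l2 l1 (x \<circ> pos) p \<ge> 0" if "p \<ge> q - int j + 2" for p
      using g[of "p + int j"] that by simp
    then have "sigma c1 c2 l1 l2 x (pos (q - int j + 2)) \<ge> 0"
      by (rule sigma_sign(2)[OF x(1)])
    with g[of q] q(2) w_nonneg[OF x, of q] sigma_pos[OF x(1), of c1 c2 l1 l2 "q - int j"]
    have "sigma c1 c2 l1 l2 x (pos (q - int j)) > 0" by simp
    moreover have "sigma c1 c2 l1 l2 x (pos (q - int j)) \<le> 0"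
    proof -
      have "iota (pos (q - int j)) \<in> {1, 2}" by (simp add: iota_pos)
      with hw e_op_None_iff[OF x(1) this] show ?thesis by blast
    qed
    ultimately show False by simp
  qed
  \<comment> \<open>Every \<open>e\<^sub>i\<close> lowers the sum of the coordinates by one, and \<open>H\<close> minimises it on the polyhedron.\<close>
  have "(x, H) \<in> ?E\<^sup>*" if "x \<in> Zinf" "?w x \<in> ?P" for x
    using that
  proof (induction "nat (sum x {k. x k \<noteq> 0} - sum H {k. H k \<noteq> 0})" arbitrary: x rule: less_induct)
    case less
    show ?case
    proof (cases "\<forall>i\<in>{1, 2}. e_op c1 c2 l1 l2 i x = None")
      case True
      then show ?thesis using unique less.prems by blast
    next
      case False
      then obtain i y where i: "i \<in> {1, 2}" and y: "e_op c1 c2 l1 l2 i x = Some y" by auto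
      obtain p where r: "raises c1 c2 l1 l2 p y x"
        using e_op_raises[OF less.prems(1) y] by blast
      then have eq: "y = x(pos p := x (pos p) + (- 1))" by (auto simp: raises_def)
      have yZ: "y \<in> Zinf" and yP: "?w y \<in> ?P"
        using less.prems(2) raises[OF r] unfolding eq by (simp_all add: Zinf_upd[OF less.prems(1)])
      have "sum y {k. y k \<noteq> 0} = sum x {k. x k \<noteq> 0} - 1"
        using sum_support_upd[OF less.prems(1), of "pos p" "- 1"] unfolding eq by simp
      moreover have "sum H {k. H k \<noteq> 0} \<le> sum y {k. y k \<noteq> 0}"
        using H_le[OF yZ yP] by (intro sum_support_le H_Zinf yZ)
      ultimately have "nat (sum y {k. y k \<noteq> 0} - sum H {k. H k \<noteq> 0})
          < nat (sum x {k. x k \<noteq> 0} - sum H {k. H k \<noteq> 0})"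
        by linarith
      then have "(y, H) \<in> ?E\<^sup>*"
        using yZ yP by (rule less.hyps)
      moreover have "(x, y) \<in> ?E"
        using less.prems(1) yZ i y by (auto simp: crystal_edges_def)
      ultimately show ?thesis by (rule converse_rtrancl_into_rtrancl[rotated])
    qed
  qed
  from this[OF _ zero] have "(\<lambda>_. 0, H) \<in> ?E\<^sup>*" by (simp add: Zinf_def)
  then have "H \<in> B0 c1 c2 l1 l2"
    using rtrancl_mono[of ?E "?E \<union> ?E\<inverse>"] by (auto simp: B0_def)
  with hw_H have "H \<in> highest_weight_vectors c1 c2 l1 l2 (B0 c1 c2 l1 l2)"
    by (simp add: highest_weight_vectors_def)
  moreover have "x = H" if "x \<in> highest_weight_vectors c1 c2 l1 l2 (B0 c1 c2 l1 l2)" for x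
    using that B0[of x] by (intro unique) (simp_all add: highest_weight_vectors_def)
  ultimately show ?thesis
    unfolding H_def[symmetric] by blast
qed

theorem theorem4p10:
  fixes c1 c2 l1 l2 :: int and k :: nat
  assumes "c1 > 0" and "c2 > 0" and "c1 * c2 \<ge> 4"
    and "l1 > 0" and "l2 < 0"
    and "k \<ge> 1"
  shows
    "((a'_seq c1 c2 (2 * k - 2) \<noteq> 0 \<longrightarrow>
         real_of_int (a'_seq c1 c2 (2 * k - 1)) / real_of_int (a'_seq c1 c2 (2 * k - 2))
           > real_of_int l1 / real_of_int (- l2)) \<and>
       real_of_int l1 / real_of_int (- l2)
         \<ge> real_of_int (a_seq c1 c2 (2 * k)) / real_of_int (a_seq c1 c2 (2 * k - 1))
       \<longrightarrow> highest_weight_vectors c1 c2 l1 l2 (B0 c1 c2 l1 l2) = {H_vec c1 c2 l1 l2 (2 * k - 1)})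
     \<and>
     (real_of_int (a_seq c1 c2 (2 * k)) / real_of_int (a_seq c1 c2 (2 * k - 1))
         > real_of_int l1 / real_of_int (- l2) \<and>
       real_of_int l1 / real_of_int (- l2)
         \<ge> real_of_int (a'_seq c1 c2 (2 * k + 1)) / real_of_int (a'_seq c1 c2 (2 * k))
       \<longrightarrow> highest_weight_vectors c1 c2 l1 l2 (B0 c1 c2 l1 l2) = {H_vec c1 c2 l1 l2 (2 * k)})"
proof -
  have c': "c2 * c1 \<ge> 4" using assms by (simp add: mult.commute)
  have a_pos: "a_seq c1 c2 n \<ge> 0" "a'_seq c1 c2 n \<ge> 0"
      "n > 0 \<Longrightarrow> a_seq c1 c2 n > 0" "n > 0 \<Longrightarrow> a'_seq c1 c2 n > 0" for n
    using alt_rec_pos[OF assms(1-3)] alt_rec_pos[OF assms(2,1) c'] gr0_conv_Suc[of n]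
    by (auto simp: a_seq_eq_alt_rec a'_seq_eq_alt_rec)
  have less: "r * l1 + s * l2 < 0"
    if "real_of_int s / real_of_int r > real_of_int l1 / real_of_int (- l2)" "r > 0" for r s :: int
  proof -
    have "real_of_int l1 * real_of_int r < real_of_int s * real_of_int (- l2)"
      using that assms(5) by (simp add: divide_less_eq less_divide_eq field_simps)
    then have "l1 * r < s * (- l2)" by (simp only: of_int_mult[symmetric] of_int_less_iff)
    then show ?thesis by (simp add: algebra_simps)
  qed
  have ge: "r * l1 + s * l2 \<ge> 0"
    if "real_of_int l1 / real_of_int (- l2) \<ge> real_of_int s / real_of_int r" "r > 0" for r s :: int
  proof -
    have "real_of_int s * real_of_int (- l2) \<le> real_of_int l1 * real_of_int r"
      using that assms(5) by (simp add: divide_le_eq le_divide_eq field_simps)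
    then have "s * (- l2) \<le> l1 * r" by (simp only: of_int_mult[symmetric] of_int_le_iff)
    then show ?thesis by (simp add: algebra_simps)
  qed
  note main = highest_weight_vectors_B0[OF assms(1-5)]
  obtain n where k: "k = Suc n" using assms(6) by (cases k) auto
  show ?thesis
  proof (intro conjI impI; elim conjE)
    assume 1: "a'_seq c1 c2 (2 * k - 2) \<noteq> 0 \<longrightarrow>
         real_of_int (a'_seq c1 c2 (2 * k - 1)) / real_of_int (a'_seq c1 c2 (2 * k - 2))
           > real_of_int l1 / real_of_int (- l2)"
      and 2: "real_of_int l1 / real_of_int (- l2)
         \<ge> real_of_int (a_seq c1 c2 (2 * k)) / real_of_int (a_seq c1 c2 (2 * k - 1))"
    have "a'_seq c1 c2 (2 * k - 2) * l1 + a'_seq c1 c2 (2 * k - 1) * l2 \<le> 0"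
      \<comment> \<open>The denominator vanishes for \<open>k = 1\<close> only; there the claim reduces to \<open>l2 < 0\<close>.\<close>
    proof (cases "a'_seq c1 c2 (2 * k - 2) = 0")
      case True
      then show ?thesis using a_pos(2)[of "2 * k - 1"] assms(5) by (simp add: mult_le_0_iff)
    next
      case False
      then have "a'_seq c1 c2 (2 * k - 2) > 0" using a_pos(2)[of "2 * k - 2"] by linarith
      then show ?thesis using less 1 False by fastforce
    qed
    moreover have "a_seq c1 c2 (2 * k - 1) * l1 + a_seq c1 c2 (2 * k) * l2 \<ge> 0"
      using ge[OF 2] a_pos(3)[of "2 * k - 1"] k by simp
    ultimately show "highest_weight_vectors c1 c2 l1 l2 (B0 c1 c2 l1 l2) = {H_vec c1 c2 l1 l2 (2 * k - 1)}"
      by (intro main) (auto simp: h_coord_def k)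
  next
    assume 1: "real_of_int (a_seq c1 c2 (2 * k)) / real_of_int (a_seq c1 c2 (2 * k - 1))
         > real_of_int l1 / real_of_int (- l2)"
      and 2: "real_of_int l1 / real_of_int (- l2)
         \<ge> real_of_int (a'_seq c1 c2 (2 * k + 1)) / real_of_int (a'_seq c1 c2 (2 * k))"
    have "a_seq c1 c2 (2 * k - 1) * l1 + a_seq c1 c2 (2 * k) * l2 \<le> 0"
      using less[OF 1] a_pos(3)[of "2 * k - 1"] k by simp
    moreover have "a'_seq c1 c2 (2 * k) * l1 + a'_seq c1 c2 (2 * k + 1) * l2 \<ge> 0"
      using ge[OF 2] a_pos(4)[of "2 * k"] k by simp
    ultimately show "highest_weight_vectors c1 c2 l1 l2 (B0 c1 c2 l1 l2) = {H_vec c1 c2 l1 l2 (2 * k)}"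
      by (intro main) (auto simp: h_coord_def k)
  qed
qed

end
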